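(* For all integers $n\geq k\geq 1$, the composita of the generating function $F(x)=\sin(x)$ is $$F^{\Delta}(n,k)=\begin{cases}\dfrac{1}{2^{k-1}n!}\displaystyle\sum_{m=0}^{\lfloor k/2\rfloor}\binom{k}{m}(2m-k)^n(-1)^{\frac{n+k}{2}-m}, & \text{if } n-k \text{ is even};\\[2mm] 0, & \text{if } n-k\text{ is odd}.\end{cases}$$
   Context: Here $\sin(x)$ denotes its Taylor series at $0$, regarded as a formal power series. For a generating function $F(x)=\sum_{n>0}f(n)x^n$ with zero constant term, its composita is the function of two variables $F^{\Delta}(n,k)=\sum f(\lambda_1)f(\lambda_2)\cdots f(\lambda_k)$, the sum being over all compositions $(\lambda_1,\dots,\lambda_k)$ of $n$ into $k$ parts (positive integers $\lambda_i$ with $\lambda_1+\cdots+\lambda_k=n$); equivalently $F^{\Delta}(n,k)=[x^n]F(x)^k$ for $k\geq 1$. *)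

theory Defs
  imports "HOL-Computational_Algebra.Formal_Power_Series"
begin

definition compositions :: "nat \<Rightarrow> nat \<Rightarrow> nat list set" where
  "compositions n k = {xs. length xs = k \<and> (\<forall>x\<in>set xs. x > 0) \<and> sum_list xs = n}"

text \<open>
  The composita is intended for series with zero constant term. The coefficient of index 0 is
  never accessed, since all parts of a composition are positive.
\<close>

definition composita :: "'a::comm_semiring_1 fps \<Rightarrow> nat \<Rightarrow> nat \<Rightarrow> 'a" where
  "composita F n k = (\<Sum>xs\<in>compositions n k. \<Prod>x\<leftarrow>xs. fps_nth F x)"

lemma finite_compositions: "finite (compositions n k)"
proof (rule finite_subset)
  show "compositions n k \<subseteq> {xs. set xs \<subseteq> {..n} \<and> length xs = k}"
    by (auto simp: compositions_def dest: member_le_sum_list)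
  show "finite {xs. set xs \<subseteq> {..n} \<and> length xs = k}"
    by (rule finite_lists_length_eq) simp
qed

end

theory Submission
  imports Defs
begin

text \<open>
  For a series without constant term, the composita is the coefficient of \<open>x\<^sup>n\<close> in the \<open>k\<close>-th
  power (\<open>composita_eq_power_nth\<close>). For the sine this power is expanded through Euler's formula:
  \<open>(2 \<i> sin x)\<^sup>k = (exp(\<i> x) - exp(- \<i> x))\<^sup>k\<close> is, by the binomial theorem, a combination of the
  exponentials \<open>exp(\<i> (2 m - k) x)\<close>, so that the coefficient is \<open>\<i>\<^sup>n / ((2 \<i>)\<^sup>k n!)\<close> times
  the real sum \<open>S\<close> of all \<open>binom(k, m) (-1)\<^bsup>k + m\<^esup> (2 m - k)\<^sup>n\<close> with \<open>m \<le> k\<close>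
  (\<open>fps_sin_power_nth\<close>).

  Exchanging \<open>m\<close> and \<open>k - m\<close> multiplies each summand by
  \<open>(-1)\<^bsup>n + k\<^esup>\<close>. If \<open>n - k\<close> is odd, this gives \<open>S = -S\<close>. If \<open>n - k\<close> is even, the summands
  pair off, the one in the middle (\<open>2 m = k\<close>) being zero because \<open>n > 0\<close>; hence \<open>S\<close> is twice the
  sum over \<open>m \<le> k div 2\<close>, and \<open>\<i>\<^bsup>n - k\<^esup>\<close> is the real sign \<open>(-1)\<^bsup>(n - k) / 2\<^esup>\<close>.
\<close>

text \<open>
  Expanding the power gives a sum over all lists of naturals with sum \<open>n\<close>, parts \<open>0\<close> included;
  the lists with such a part contribute nothing because of the factor \<open>fps_nth F 0\<close>.
\<close>
lemma composita_eq_power_nth: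
  fixes F :: "'a::comm_ring_1 fps"
  assumes "fps_nth F 0 = 0" and "0 < k"
  shows "composita F n k = fps_nth (F ^ k) n"
proof -
  have prod_nth: "(\<Prod>j = 0..k - 1. fps_nth F (xs ! j)) = (\<Prod>x\<leftarrow>xs. fps_nth F x)"
    if "xs \<in> natpermute n k" for xs
  proof -
    have len: "length xs = k" using that by (simp add: natpermute_def)
    have "{0..k - 1} = {0..<k}" using assms(2) by auto
    moreover have "(\<Prod>x\<leftarrow>xs. fps_nth F x) = (\<Prod>j = 0..<k. fps_nth F (xs ! j))"
      by (simp add: prod.list_conv_set_nth len)
    ultimately show ?thesis by simp
  qed
  have "composita F n k = (\<Sum>xs\<in>natpermute n k. \<Prod>x\<leftarrow>xs. fps_nth F x)"
    unfolding composita_def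
  proof (rule sum.mono_neutral_left)
    show "finite (natpermute n k)" by (rule natpermute_finite)
    show "compositions n k \<subseteq> natpermute n k"
      by (auto simp: compositions_def natpermute_def)
    show "\<forall>xs\<in>natpermute n k - compositions n k. (\<Prod>x\<leftarrow>xs. fps_nth F x) = 0"
    proof
      fix xs assume "xs \<in> natpermute n k - compositions n k"
      then have "0 \<in> set xs" by (auto simp: compositions_def natpermute_def)
      then show "(\<Prod>x\<leftarrow>xs. fps_nth F x) = 0"
        using assms(1) by (induction xs) auto
    qed
  qed
  also have "\<dots> = fps_nth (F ^ k) n"
    unfolding fps_power_nth using assms(2) prod_nth by simp
  finally show ?thesis .
qed

lemma of_real_composita:
  "of_real (composita F n k) =
    composita (Abs_fps (\<lambda>i. of_real (fps_nth F i) :: 'a::{real_algebra_1, comm_ring_1})) n k"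
proof -
  have "of_real (\<Prod>x\<leftarrow>xs. fps_nth F x) = (\<Prod>x\<leftarrow>xs. of_real (fps_nth F x) :: 'a)" for xs
    by (induction xs) auto
  then show ?thesis
    by (simp add: composita_def)
qed

lemma fps_sin_power_nth:
  "fps_nth (fps_sin (1::complex) ^ k) n * (2 * \<i>) ^ k =
    \<i> ^ n / fact n *
      of_real (\<Sum>m = 0..k. real (k choose m) * (-1) ^ (k + m) * (2 * real m - real k) ^ n)"
proof -
  have "fps_sin (1::complex) * fps_const (2 * \<i>) = fps_exp \<i> + fps_const (-1) * fps_exp (- \<i>)"
    using fps_exp_ii_sin_cos[of 1] fps_exp_minus_ii_sin_cos[of 1]
    by (intro fps_ext) simp
  then have "fps_sin (1::complex) ^ k * fps_const ((2 * \<i>) ^ k) =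
      (fps_exp \<i> + fps_const (-1) * fps_exp (- \<i>)) ^ k"
    by (metis power_mult_distrib fps_const_power)
  also have "\<dots> = (\<Sum>m = 0..k.
      fps_const (of_nat (k choose m) * (-1) ^ (k - m)) * fps_exp (\<i> * (2 * of_nat m - of_nat k)))"
    unfolding binomial_ring atLeast0AtMost
  proof (rule sum.cong)
    fix m assume "m \<in> {..k}"
    then have "of_nat m * \<i> + of_nat (k - m) * (- \<i>) = \<i> * (2 * of_nat m - of_nat k)"
      by (simp add: of_nat_diff algebra_simps)
    then have "fps_exp \<i> ^ m * fps_exp (- \<i>) ^ (k - m) = fps_exp (\<i> * (2 * of_nat m - of_nat k))"
      by (simp add: fps_exp_power_mult flip: fps_exp_add_mult)
    then show "of_nat (k choose m) * fps_exp \<i> ^ m * (fps_const (-1) * fps_exp (- \<i>)) ^ (k - m) =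
        fps_const (of_nat (k choose m) * (-1) ^ (k - m)) * fps_exp (\<i> * (2 * of_nat m - of_nat k))"
      by (simp add: power_mult_distrib fps_of_nat mult_ac flip: fps_const_mult fps_const_power)
  qed simp
  finally have "fps_nth (fps_sin (1::complex) ^ k * fps_const ((2 * \<i>) ^ k)) n = fps_nth \<dots> n"
    by simp
  then have "fps_nth (fps_sin (1::complex) ^ k) n * (2 * \<i>) ^ k =
      (\<Sum>m = 0..k. of_nat (k choose m) * (-1) ^ (k - m) *
        ((\<i> * (2 * of_nat m - of_nat k)) ^ n / fact n))"
    by (simp add: fps_sum_nth)
  also have "\<dots> = (\<Sum>m = 0..k. \<i> ^ n / fact n *
      of_real (real (k choose m) * (-1) ^ (k + m) * (2 * real m - real k) ^ n))"
  proof (rule sum.cong)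
    fix m assume "m \<in> {0..k}"
    then have "(-1) ^ (k - m) = ((-1) ^ (k + m) :: complex)"
      by (simp add: minus_one_power_iff)
    then show "of_nat (k choose m) * (-1) ^ (k - m) *
          ((\<i> * (2 * of_nat m - of_nat k)) ^ n / fact n) =
        \<i> ^ n / fact n *
          of_real (real (k choose m) * (-1) ^ (k + m) * (2 * real m - real k) ^ n)"
      by (simp add: power_mult_distrib)
  qed simp
  finally show ?thesis
    by (simp add: sum_distrib_left)
qed

lemma sum_symmetric_eq_twice_half:
  fixes f :: "nat \<Rightarrow> 'a::comm_semiring_1"
  assumes sym: "\<And>m. m \<le> k \<Longrightarrow> f (k - m) = f m"
    and middle: "\<And>m. 2 * m = k \<Longrightarrow> f m = 0"
  shows "(\<Sum>m = 0..k. f m) = 2 * (\<Sum>m = 0..k div 2. f m)"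
proof -
  have "(\<Sum>m = k div 2 + 1..k. f m) = (\<Sum>m\<in>{m. 2 * m < k}. f m)"
    by (rule sum.reindex_bij_witness[where i = "\<lambda>m. k - m" and j = "\<lambda>m. k - m"])
      (auto simp: sym)
  also have "\<dots> = (\<Sum>m = 0..k div 2. f m)"
  proof (rule sum.mono_neutral_left)
    show "\<forall>m\<in>{0..k div 2} - {m. 2 * m < k}. f m = 0"
      by (intro ballI middle) auto
  qed auto
  finally have "(\<Sum>m = k div 2 + 1..k. f m) = (\<Sum>m = 0..k div 2. f m)" .
  moreover have "(\<Sum>m = 0..k. f m) = (\<Sum>m = 0..k div 2. f m) + (\<Sum>m = k div 2 + 1..k. f m)"
    using sum.ub_add_nat[of 0 "k div 2" f "k - k div 2"] by simp
  ultimately show ?thesis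
    by (simp add: mult_2)
qed

theorem mainTheorem4:
  fixes n k :: nat
  assumes "1 \<le> k" and "k \<le> n"
  shows "composita (fps_sin (1::real)) n k =
    (if even (n - k)
     then 1 / (2 ^ (k - 1) * fact n) *
       (\<Sum>m = 0..k div 2. real (k choose m) * (2 * real m - real k) ^ n
          * (-1) powi ((int n + int k) div 2 - int m))
     else 0)"
proof -
  define c where "c = composita (fps_sin (1::real)) n k"
  define T where "T m = real (k choose m) * (-1) ^ (k + m) * (2 * real m - real k) ^ n" for m
  have "Abs_fps (\<lambda>i. of_real (fps_nth (fps_sin (1::real)) i)) = fps_sin (1::complex)"
    by (rule fps_ext) (simp add: fps_sin_def)
  then have "of_real c = composita (fps_sin (1::complex)) n k"
    by (simp add: c_def of_real_composita)
  also have "\<dots> = fps_nth (fps_sin 1 ^ k) n"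
    using assms(1) by (simp add: composita_eq_power_nth)
  finally have c: "of_real c * (2 * \<i>) ^ k = \<i> ^ n / fact n * of_real (\<Sum>m = 0..k. T m)"
    using fps_sin_power_nth[of k n] by (simp add: T_def)
  have T_reflect: "T (k - m) = (-1) ^ (n + k) * T m" if "m \<le> k" for m
  proof -
    have "2 * real (k - m) - real k = (-1) * (2 * real m - real k)"
      using that by (simp add: of_nat_diff)
    then have "(2 * real (k - m) - real k) ^ n = (-1) ^ n * (2 * real m - real k) ^ n"
      by (metis power_mult_distrib)
    moreover have "(-1) ^ (k + (k - m)) = ((-1) ^ k * (-1) ^ (k + m) :: real)"
      using that by (simp add: minus_one_power_iff)
    ultimately show ?thesis
      using that by (simp add: T_def power_add flip: binomial_symmetric)
  qed
  show ?thesis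
  proof (cases "even (n - k)")
    case True
    then obtain j where "n - k = 2 * j" ..
    then have n: "n = k + 2 * j" using assms(2) by simp
    have "(\<Sum>m = 0..k. T m) = 2 * (\<Sum>m = 0..k div 2. T m)"
    proof (rule sum_symmetric_eq_twice_half)
      show "T (k - m) = T m" if "m \<le> k" for m
        using T_reflect[OF that] by (simp add: n)
      show "T m = 0" if "2 * m = k" for m
        using that assms by (auto simp: T_def)
    qed
    then have "of_real c * (2 ^ k * \<i> ^ k) =
        \<i> ^ k * (-1) ^ j / fact n * of_real (2 * (\<Sum>m = 0..k div 2. T m))"
      using c by (simp add: power_mult_distrib n power_add power_mult)
    then have "\<i> ^ k * of_real (c * 2 ^ k) =
        \<i> ^ k * of_real ((-1) ^ j / fact n * (2 * (\<Sum>m = 0..k div 2. T m)))"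
      by (simp add: mult_ac)
    then have "c * 2 ^ k = (-1) ^ j / fact n * (2 * (\<Sum>m = 0..k div 2. T m))"
      by (simp only: mult_cancel_left of_real_eq_iff) simp
    moreover have "(2::real) ^ k = 2 * 2 ^ (k - 1)"
      using assms(1) by (simp flip: power_Suc)
    ultimately have "c = 1 / (2 ^ (k - 1) * fact n) * ((-1) ^ j * (\<Sum>m = 0..k div 2. T m))"
      by (simp add: field_simps)
    also have "(-1) ^ j * (\<Sum>m = 0..k div 2. T m) =
        (\<Sum>m = 0..k div 2. real (k choose m) * (2 * real m - real k) ^ n
          * (-1) powi ((int n + int k) div 2 - int m))"
      unfolding sum_distrib_left
    proof (rule sum.cong)
      fix m assume "m \<in> {0..k div 2}"
      then have "m \<le> k" by simp
      then have "(int n + int k) div 2 - int m = int (j + (k - m))"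
        by (simp add: n)
      then have "(-1) powi ((int n + int k) div 2 - int m) = ((-1) ^ (j + (k - m)) :: real)"
        by (simp only: power_int_of_nat)
      also have "\<dots> = (-1) ^ j * (-1) ^ (k + m)"
        using \<open>m \<le> k\<close> by (simp add: minus_one_power_iff)
      finally show "(-1) ^ j * T m = real (k choose m) * (2 * real m - real k) ^ n
          * (-1) powi ((int n + int k) div 2 - int m)"
        by (simp add: T_def)
    qed simp
    finally show ?thesis
      using True by (simp add: c_def)
  next
    case False
    then have "odd (n + k)" using assms(2) by simp
    have "(\<Sum>m = 0..k. T m) = (\<Sum>m = 0..k. T (k - m))"
      using sum.atLeastAtMost_rev[of T 0 k] by simp
    also have "\<dots> = - (\<Sum>m = 0..k. T m)"
      using \<open>odd (n + k)\<close> by (simp add: T_reflect sum_negf)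
    finally have "c = 0"
      using c by simp
    then show ?thesis
      using False by (simp add: c_def)
  qed
qed

end
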